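(* Let $X$ be a Banach space whose norm $\|\cdot\|$ is Fréchet differentiable, and let $f:X\to\mathbb{R}\cup\{+\infty\}$ be a convex lower semicontinuous function such that $\lim_{\|x\|\to\infty}\frac{f(x)}{\|x\|}=\infty$. Suppose further that $(f_\alpha)$ is a net of lower semicontinuous convex functions $f_\alpha:X\to\mathbb{R}\cup\{+\infty\}$ such that $\operatorname{epi} f_\alpha$ converges Wijsman to $\operatorname{epi} f$ in $Y=X\times\mathbb{R}$ endowed with the $\ell_2$ product norm $\|(x,r)\|=(\|x\|^2+|r|^2)^{1/2}$. (a) If $X$ has the Radon-Nikodým property, then $\operatorname{epi} f_\alpha$ converges slice to $\operatorname{epi} f$. (b) If $f$ has weakly compact level sets (i.e. $\{x\in X: f(x)\le t\}$ is weakly compact for every $t\in\mathbb{R}$), then $\operatorname{epi} f_\alpha$ converges slice to $\operatorname{epi} f$.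
   Context: Banach spaces are real and $X$ is infinite dimensional. A norm is Fréchet differentiable if it is Fréchet differentiable at every nonzero point. $\operatorname{epi} f=\{(x,r)\in X\times\mathbb{R}: f(x)\le r\}$. A Banach space has the Radon-Nikodým property (RNP) if every nonempty closed bounded convex subset has slices of arbitrarily small diameter. $d(x,A)=\inf\{\|x-a\|:a\in A\}$ and $d(A,B)=\inf\{\|a-b\|:a\in A,b\in B\}$, with value $\infty$ if a set involved is empty. For closed convex subsets $C_\alpha$ (a net), $C$ of a Banach space $Y$: $C_\alpha$ converges Wijsman to $C$ in $Y$ if $\lim_\alpha d(y,C_\alpha)=d(y,C)$ for all $y\in Y$; $C_\alpha$ converges slice to $C$ in $Y$ if $\lim_\alpha d(W,C_\alpha)=d(W,C)$ for all closed bounded convex $W\subset Y$. *)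

theory Defs
  imports "HOL-Analysis.Analysis"
begin

definition infinite_dimensional :: "'a::real_vector itself \<Rightarrow> bool" where
  "infinite_dimensional _ \<longleftrightarrow> \<not> (\<exists>B::'a set. finite B \<and> span B = UNIV)"

(* "norm differentiable at x" is Frechet differentiability, since has_derivative requires a
   bounded linear derivative with a remainder of order o(norm h). *)
definition frechet_differentiable_norm :: "'a::real_normed_vector itself \<Rightarrow> bool" where
  "frechet_differentiable_norm _ \<longleftrightarrow>
    (\<forall>x::'a. x \<noteq> 0 \<longrightarrow> (norm :: 'a \<Rightarrow> real) differentiable (at x))"

definition slice :: "'a::real_normed_vector set \<Rightarrow> ('a \<Rightarrow>\<^sub>L real) \<Rightarrow> real \<Rightarrow> 'a set" where
  "slice C \<phi> \<delta> = {x \<in> C. blinfun_apply \<phi> x > (SUP y\<in>C. blinfun_apply \<phi> y) - \<delta>}"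

definition radon_nikodym_property :: "'a::real_normed_vector itself \<Rightarrow> bool" where
  "radon_nikodym_property _ \<longleftrightarrow>
    (\<forall>C::'a set. C \<noteq> {} \<and> closed C \<and> bounded C \<and> convex C \<longrightarrow>
      (\<forall>\<epsilon>>0. \<exists>\<phi>. \<exists>\<delta>>0. diameter (slice C \<phi> \<delta>) < \<epsilon>))"

definition weak_topology :: "'a::real_normed_vector topology" where
  "weak_topology =
    topology_generated_by {blinfun_apply \<phi> -` U | (\<phi> :: 'a \<Rightarrow>\<^sub>L real) U. open U}"

lemma topspace_weak_topology [simp]: "topspace weak_topology = UNIV"
proof -
  have "UNIV = blinfun_apply (0 :: 'a \<Rightarrow>\<^sub>L real) -` UNIV" by simp
  then show ?thesis
    unfolding weak_topology_def topology_generated_by_topspace by blast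
qed

(* Extended-real-valued functions into the reals with plus infinity are modelled as ereal-valued
   functions that never take the value minus infinity. Under that condition the right-hand side
   of the convexity inequality below never involves a sum of opposite infinities. *)
definition never_minus_infinity :: "('a \<Rightarrow> ereal) \<Rightarrow> bool" where
  "never_minus_infinity f \<longleftrightarrow> (\<forall>x. f x \<noteq> - \<infinity>)"

definition convex_fun :: "('a::real_vector \<Rightarrow> ereal) \<Rightarrow> bool" where
  "convex_fun f \<longleftrightarrow>
    (\<forall>x y. \<forall>t::real. 0 < t \<and> t < 1 \<longrightarrow>
      f ((1 - t) *\<^sub>R x + t *\<^sub>R y) \<le> ereal (1 - t) * f x + ereal t * f y)"

definition lsc_fun :: "('a::topological_space \<Rightarrow> ereal) \<Rightarrow> bool" where
  "lsc_fun f \<longleftrightarrow> (\<forall>x. f x \<le> Liminf (at x) f)"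

definition epi :: "('a \<Rightarrow> ereal) \<Rightarrow> ('a \<times> real) set" where
  "epi f = {(x, r). f x \<le> ereal r}"

(* The library's infdist and setdist are 0 on empty sets; here the value is \<infinity>,
   the infimum of the empty set in ereal. *)
definition pt_dist :: "'a::real_normed_vector \<Rightarrow> 'a set \<Rightarrow> ereal" where
  "pt_dist x A = (INF a\<in>A. ereal (norm (x - a)))"

definition gap_dist :: "'a::real_normed_vector set \<Rightarrow> 'a set \<Rightarrow> ereal" where
  "gap_dist A B = (INF a\<in>A. INF b\<in>B. ereal (norm (a - b)))"

(* A net is a family indexed by a directed set (I, r), where (i, j) \<in> r means that j is
   beyond i; limits along the net are limits along its filter of tails. *)
definition directed_set :: "'i set \<Rightarrow> 'i rel \<Rightarrow> bool" where
  "directed_set I r \<longleftrightarrow>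
    I \<noteq> {} \<and> preorder_on I r \<and> (\<forall>i\<in>I. \<forall>j\<in>I. \<exists>k\<in>I. (i, k) \<in> r \<and> (j, k) \<in> r)"

definition net_filter :: "'i set \<Rightarrow> 'i rel \<Rightarrow> 'i filter" where
  "net_filter I r = (INF i\<in>I. principal {j \<in> I. (i, j) \<in> r})"

lemma eventually_net_filter:
  assumes "directed_set I r"
  shows "eventually P (net_filter I r) \<longleftrightarrow> (\<exists>i\<in>I. \<forall>j\<in>I. (i, j) \<in> r \<longrightarrow> P j)"
proof -
  have tr: "trans r" and ne: "I \<noteq> {}"
    and ub: "\<forall>i\<in>I. \<forall>j\<in>I. \<exists>k\<in>I. (i, k) \<in> r \<and> (j, k) \<in> r"
    using assms by (simp_all add: directed_set_def preorder_on_def)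
  have base: "\<exists>k\<in>I. principal {l \<in> I. (k, l) \<in> r} \<le>
      inf (principal {l \<in> I. (i, l) \<in> r}) (principal {l \<in> I. (j, l) \<in> r})"
    if i: "i \<in> I" and j: "j \<in> I" for i j
  proof -
    from ub[rule_format, OF i j] obtain k where k: "k \<in> I" "(i, k) \<in> r" "(j, k) \<in> r"
      by blast
    have "{l \<in> I. (k, l) \<in> r} \<subseteq> {l \<in> I. (i, l) \<in> r} \<inter> {l \<in> I. (j, l) \<in> r}"
    proof
      fix l assume "l \<in> {l \<in> I. (k, l) \<in> r}"
      then show "l \<in> {l \<in> I. (i, l) \<in> r} \<inter> {l \<in> I. (j, l) \<in> r}"
        using transD[OF tr k(2)] transD[OF tr k(3)] by simp
    qed
    with k(1) show ?thesis
      by (intro bexI[of _ k]) simp_all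
  qed
  have "eventually P (net_filter I r) \<longleftrightarrow>
      (\<exists>i\<in>I. eventually P (principal {j \<in> I. (i, j) \<in> r}))"
    unfolding net_filter_def by (rule eventually_INF_base[OF ne base])
  then show ?thesis
    by (simp add: eventually_principal Ball_def imp_conjL)
qed

definition wijsman_converges ::
  "('i \<Rightarrow> 'y::real_normed_vector set) \<Rightarrow> 'y set \<Rightarrow> 'i filter \<Rightarrow> bool" where
  "wijsman_converges C C0 F \<longleftrightarrow>
    (\<forall>y. ((\<lambda>\<alpha>. pt_dist y (C \<alpha>)) \<longlongrightarrow> pt_dist y C0) F)"

definition slice_converges ::
  "('i \<Rightarrow> 'y::real_normed_vector set) \<Rightarrow> 'y set \<Rightarrow> 'i filter \<Rightarrow> bool" where
  "slice_converges C C0 F \<longleftrightarrow>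
    (\<forall>W. closed W \<and> bounded W \<and> convex W \<longrightarrow>
      ((\<lambda>\<alpha>. gap_dist W (C \<alpha>)) \<longlongrightarrow> gap_dist W C0) F)"

end

theory Submission
  imports Defs
begin

text \<open>
  Write \<open>Q = \<parallel>\<cdot>\<parallel>\<^sup>2\<close>, which is Frechet differentiable on all of \<open>X \<times> \<real>\<close>. If \<open>\<phi> = DQ(u)\<close> has
  near-maximisers \<open>c\<close> on a convex set \<open>C\<close> that stay in a fixed ball, then the distances
  \<open>d(c + u, C\<^sub>\<alpha>)\<close> alone force \<open>\<phi> \<le> sup \<phi>(C) + \<epsilon>\<close> on bounded parts of \<open>C\<^sub>\<alpha>\<close>: a point of \<open>C\<^sub>\<alpha>\<close> violating
  this would, by a short step from \<open>c\<close> towards it, come too close to \<open>c + u\<close>.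

  Such a \<open>\<phi>\<close> separating a bounded convex set \<open>W\<close> from \<open>C = epi f\<close> comes from Ekeland's principle
  for \<open>Q\<close> on the closure of \<open>W - C\<close>. It gives \<open>v\<close> such that \<open>DQ(v)\<close> separates up to an error
  \<open>\<epsilon>\<parallel>\<cdot>\<parallel>\<close>; replacing \<open>v\<close> by \<open>v - (0, \<kappa>/2)\<close> tilts \<open>DQ(v)\<close> by \<open>-\<kappa>\<close> in the last coordinate, which
  absorbs the error because \<open>f(x) \<ge> \<parallel>x\<parallel> - B\<close>, and bounds the near-maximisers.
\<close>

section \<open>Ekeland's variational principle\<close>

text \<open>Nested closed sets: \<open>S v\<close> holds the points at which \<open>g\<close> lies
  below \<open>g v\<close> by at least \<open>e\<close> times the distance to \<open>v\<close>.
  Near-minimising \<open>g\<close> on one such set after another drives the diameters to 0, so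
  completeness yields a common point \<open>v\<close>. A point violating the last claim would lie in
  all these sets and hence equal \<open>v\<close>.\<close>

lemma ekeland:
  fixes g :: "'y::banach \<Rightarrow> real"
  assumes cl: "closed K" and cont: "continuous_on UNIV g" and nn: "\<And>v. v \<in> K \<Longrightarrow> g v \<ge> 0"
    and x0: "x0 \<in> K" and e: "e > 0"
  obtains v where "v \<in> K" "g v \<le> g x0" "\<And>y. y \<in> K \<Longrightarrow> g y \<ge> g v - e * norm (y - v)"
proof -
  define S where "S v = {y \<in> K. g y + e * norm (y - v) \<le> g v}" for v
  have self: "v \<in> S v" if "v \<in> K" for v
    using that by (simp add: S_def)
  have sub: "S y \<subseteq> S v" if "y \<in> S v" for y v
  proof
    fix z assume z: "z \<in> S y"
    have "norm (z - v) \<le> norm (z - y) + norm (y - v)"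
      using norm_triangle_ineq[of "z - y" "y - v"] by simp
    then have "e * norm (z - v) \<le> e * norm (z - y) + e * norm (y - v)"
      using e by (simp flip: distrib_left)
    then show "z \<in> S v"
      using z that by (auto simp: S_def)
  qed
  have ex: "\<exists>y. y \<in> S v \<and> (\<forall>z\<in>S v. g y \<le> g z + 1 / real (Suc n))" if "v \<in> K" for v n
  proof -
    have ne: "g ` S v \<noteq> {}" and bdd: "bdd_below (g ` S v)"
      using self[OF that] nn by (auto simp: S_def intro!: bdd_belowI[of _ 0])
    have "Inf (g ` S v) < Inf (g ` S v) + 1 / real (Suc n)"
      by simp
    then obtain y where y: "y \<in> S v" "g y < Inf (g ` S v) + 1 / real (Suc n)"
      using cInf_lessD[OF ne] by (metis imageE)
    moreover have "Inf (g ` S v) \<le> g z" if "z \<in> S v" for z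
      using that bdd by (simp add: cInf_lower)
    ultimately show ?thesis
      by (meson add_right_mono less_imp_le order_trans)
  qed
  define nxt where "nxt n v = (SOME y. y \<in> S v \<and> (\<forall>z\<in>S v. g y \<le> g z + 1 / real (Suc n)))" for n v
  have nxt: "nxt n v \<in> S v" "\<And>z. z \<in> S v \<Longrightarrow> g (nxt n v) \<le> g z + 1 / real (Suc n)"
    if "v \<in> K" for n v
    using someI_ex[OF ex[OF that]] unfolding nxt_def by blast+
  define s where "s = rec_nat x0 nxt"
  have s0: "s 0 = x0" and sS: "s (Suc n) = nxt n (s n)" for n
    by (simp_all add: s_def)
  have sK: "s n \<in> K" for n
  proof (induction n)
    case 0 then show ?case using x0 by (simp add: s0)
  next
    case (Suc n) then show ?case using nxt(1)[OF Suc] by (simp add: sS S_def)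
  qed
  have dec: "S (s (Suc n)) \<subseteq> S (s n)" for n
    using sub nxt(1)[OF sK] by (simp add: sS)
  \<comment> \<open>Such a \<open>z\<close> already competed when \<open>s (Suc n)\<close> was
    chosen, so \<open>g\<close> can drop from \<open>s (Suc n)\<close> to \<open>z\<close> by at
    most the tolerance; membership in \<open>S (s (Suc n))\<close> bounds the distance by that
    drop.\<close>
  have small: "e * norm (z - s (Suc n)) \<le> 1 / real (Suc n)" if "z \<in> S (s (Suc n))" for z n
  proof -
    have "g (s (Suc n)) \<le> g z + 1 / real (Suc n)"
      using nxt(2)[OF sK, of z n n] that dec[of n] by (auto simp: sS)
    then show ?thesis
      using that by (auto simp: S_def)
  qed
  have close: "\<exists>n. \<forall>x\<in>S (s n). \<forall>y\<in>S (s n). dist x y < r" if "r > 0" for r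
  proof -
    obtain n where n: "inverse (real (Suc n)) < e * r / 2"
      using reals_Archimedean[of "e * r / 2"] e \<open>r > 0\<close> by auto
    have half: "norm (x - s (Suc n)) < r / 2" if "x \<in> S (s (Suc n))" for x
    proof -
      have "e * norm (x - s (Suc n)) < e * (r / 2)"
        using small[OF that] n by (simp add: inverse_eq_divide)
      then show ?thesis
        using e by simp
    qed
    have "dist x y < r" if "x \<in> S (s (Suc n))" "y \<in> S (s (Suc n))" for x y
      using half[OF that(1)] half[OF that(2)]
      by (metis dist_norm dist_commute dist_triangle_half_l)
    then show ?thesis by blast
  qed
  have clS: "closed (S v)" for v
  proof -
    have "S v = K \<inter> {y. g y + e * norm (y - v) \<le> g v}"
      by (auto simp: S_def)
    moreover have "closed {y. g y + e * norm (y - v) \<le> g v}"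
      using cont by (intro closed_Collect_le continuous_intros) auto
    ultimately show ?thesis
      using cl by auto
  qed
  have anti: "S (s n) \<subseteq> S (s m)" if "m \<le> n" for m n
    using lift_Suc_antimono_le[of "\<lambda>n. S (s n)", OF dec that] .
  have "S (s n) \<noteq> {}" for n
    using self[OF sK] by blast
  then obtain v where v: "\<And>n. v \<in> S (s n)"
    using decreasing_closed_nest[of "\<lambda>n. S (s n)", OF clS _ anti close] by blast
  show thesis
  proof
    show "v \<in> K"
      using v[of 0] by (simp add: S_def)
    have "0 \<le> e * norm (v - x0)"
      using e by simp
    then show "g v \<le> g x0"
      using v[of 0] unfolding s0 S_def by auto
    show "g y \<ge> g v - e * norm (y - v)" if "y \<in> K" for y
    proof (rule ccontr)
      assume neg: "\<not> g y \<ge> g v - e * norm (y - v)"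
      then have "y \<in> S v"
        using that by (simp add: S_def)
      then have "y \<in> S (s n)" for n
        using sub[OF v] by blast
      then have "dist y v < r" if "r > 0" for r
        using close[OF that] v by blast
      then have "y = v"
        by (metis dist_eq_0_iff less_irrefl zero_less_dist_iff)
      with neg show False
        by simp
    qed
  qed
qed

section \<open>Derivatives of the squared norm\<close>

text \<open>Later estimates of \<open>D h\<close> come from convexity along a ray, so they control
  the quotients for small positive \<open>t\<close> only.\<close>

lemma has_derivative_imp_directional:
  fixes F :: "'y::real_normed_vector \<Rightarrow> real"
  assumes "(F has_derivative D) (at v)"
  shows "((\<lambda>t. (F (v + t *\<^sub>R h) - F v) / t) \<longlongrightarrow> D h) (at_right 0)"
proof -
  have lin: "linear D"
    using assms has_derivative_linear by blast
  have "((\<lambda>t. F (v + t *\<^sub>R h)) has_derivative (\<lambda>t. D (t *\<^sub>R h))) (at (0::real))"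
    using assms
    by (intro has_derivative_compose[where f = "\<lambda>t. v + t *\<^sub>R h" and g = F])
       (auto intro!: derivative_eq_intros)
  then have "((\<lambda>t. F (v + t *\<^sub>R h)) has_real_derivative D h) (at 0)"
    unfolding has_field_derivative_def
    by (simp add: linear_scale[OF lin] mult.commute[of _ "D h"])
  then have "((\<lambda>t. (F (v + t *\<^sub>R h) - F v) / t) \<longlongrightarrow> D h) (at 0)"
    by (simp add: has_field_derivative_iff)
  then show ?thesis
    by (rule tendsto_mono[rotated]) (simp add: at_le)
qed

lemma norm_sq_convex_step:
  fixes v h :: "'y::real_normed_vector"
  assumes "0 < t" "t < 1"
  shows "(norm (v + t *\<^sub>R h))\<^sup>2 \<le> (1 - t) * (norm v)\<^sup>2 + t * (norm (v + h))\<^sup>2"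
proof -
  have "v + t *\<^sub>R h = (1 - t) *\<^sub>R v + t *\<^sub>R (v + h)"
    by (simp add: algebra_simps)
  then have "norm (v + t *\<^sub>R h) \<le> (1 - t) * norm v + t * norm (v + h)"
    using norm_triangle_ineq[of "(1 - t) *\<^sub>R v" "t *\<^sub>R (v + h)"] assms by simp
  then have "(norm (v + t *\<^sub>R h))\<^sup>2 \<le> ((1 - t) * norm v + t * norm (v + h))\<^sup>2"
    by (intro power_mono) auto
  also have "\<dots> = (1 - t) * (norm v)\<^sup>2 + t * (norm (v + h))\<^sup>2
      - t * (1 - t) * (norm v - norm (v + h))\<^sup>2"
    by (simp add: power2_eq_square algebra_simps)
  also have "\<dots> \<le> (1 - t) * (norm v)\<^sup>2 + t * (norm (v + h))\<^sup>2"
    using assms by simp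
  finally show ?thesis .
qed

context
  fixes D :: "'y::real_normed_vector \<Rightarrow> real" and v :: 'y
  assumes D: "((\<lambda>y. (norm y)\<^sup>2) has_derivative D) (at v)"
begin

text \<open>By convexity the difference quotient at \<open>t\<close> in (0,1) is at most the one at
  1; let \<open>t\<close> tend to 0.\<close>

lemma norm_sq_above_tangent: "(norm (v + h))\<^sup>2 \<ge> (norm v)\<^sup>2 + D h"
proof -
  have "D h \<le> (norm (v + h))\<^sup>2 - (norm v)\<^sup>2"
  proof (rule tendsto_upperbound[OF has_derivative_imp_directional[OF D]])
    have "\<forall>\<^sub>F t in at_right (0::real). t \<in> {0<..<1}"
      by (rule eventually_at_right_real) simp
    then show "\<forall>\<^sub>F t in at_right 0.
        ((norm (v + t *\<^sub>R h))\<^sup>2 - (norm v)\<^sup>2) / t \<le> (norm (v + h))\<^sup>2 - (norm v)\<^sup>2"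
    proof eventually_elim
      case (elim t)
      then show ?case
        using norm_sq_convex_step[of t v h] by (simp add: pos_divide_le_eq) (simp add: algebra_simps)
    qed
  qed simp
  then show ?thesis by simp
qed

lemma norm_sq_derivative_le: "D h \<le> 2 * norm v * norm h"
proof (rule tendsto_le[OF _ _ has_derivative_imp_directional[OF D]])
  have "((\<lambda>t. 2 * norm v * norm h + t * (norm h)\<^sup>2) \<longlongrightarrow> 2 * norm v * norm h + 0 * (norm h)\<^sup>2) (at_right 0)"
    by (intro tendsto_intros)
  then show "((\<lambda>t. 2 * norm v * norm h + t * (norm h)\<^sup>2) \<longlongrightarrow> 2 * norm v * norm h) (at_right 0)"
    by simp
  have "\<forall>\<^sub>F t in at_right (0::real). t \<in> {0<..<1}"
    by (rule eventually_at_right_real) simp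
  then show "\<forall>\<^sub>F t in at_right 0.
      ((norm (v + t *\<^sub>R h))\<^sup>2 - (norm v)\<^sup>2) / t \<le> 2 * norm v * norm h + t * (norm h)\<^sup>2"
  proof eventually_elim
    case (elim t)
    have "norm (v + t *\<^sub>R h) \<le> norm v + t * norm h"
      using norm_triangle_ineq[of v "t *\<^sub>R h"] elim by simp
    then have "(norm (v + t *\<^sub>R h))\<^sup>2 \<le> (norm v + t * norm h)\<^sup>2"
      by (intro power_mono) auto
    then show ?case
      using elim by (simp add: pos_divide_le_eq power2_eq_square) (simp add: algebra_simps)
  qed
qed simp

text \<open>Along the ray towards the origin the squared norm is exactly
  \<open>(1 - t)\<^sup>2 * (norm v)\<^sup>2\<close>, so its slope can be read off.\<close>

lemma norm_sq_derivative_self: "D v \<ge> 2 * (norm v)\<^sup>2"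
proof -
  have lin: "linear D"
    using D has_derivative_linear by blast
  have "- 2 * (norm v)\<^sup>2 \<ge> D (- v)"
  proof (rule tendsto_le[OF _ _ has_derivative_imp_directional[OF D]])
    have "((\<lambda>t. - 2 * (norm v)\<^sup>2 + t * (norm v)\<^sup>2) \<longlongrightarrow> - 2 * (norm v)\<^sup>2 + 0 * (norm v)\<^sup>2) (at_right 0)"
      by (intro tendsto_intros)
    then show "((\<lambda>t. - 2 * (norm v)\<^sup>2 + t * (norm v)\<^sup>2) \<longlongrightarrow> - 2 * (norm v)\<^sup>2) (at_right 0)"
      by simp
    have "\<forall>\<^sub>F t in at_right (0::real). t \<in> {0<..<1}"
      by (rule eventually_at_right_real) simp
    then show "\<forall>\<^sub>F t in at_right 0.
        ((norm (v + t *\<^sub>R - v))\<^sup>2 - (norm v)\<^sup>2) / t \<le> - 2 * (norm v)\<^sup>2 + t * (norm v)\<^sup>2"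
    proof eventually_elim
      case (elim t)
      have "v + t *\<^sub>R - v = (1 - t) *\<^sub>R v"
        by (simp add: algebra_simps)
      then have "norm (v + t *\<^sub>R - v) = (1 - t) * norm v"
        using elim by simp
      then show ?case
        using elim by (simp add: pos_divide_le_eq power2_eq_square) (simp add: algebra_simps)
    qed
  qed simp
  then show ?thesis
    using linear_neg[OF lin] by simp
qed

end

section \<open>From Wijsman convergence to bounds on a functional\<close>

text \<open>Only the distances from \<open>c0\<close> and from \<open>c0 + u\<close> are tested. The
  order of choices matters: the step length \<open>t\<close> comes from the Frechet remainder and
  the radii \<open>K\<close>, \<open>M\<close>; then \<open>\<delta>\<close> comes from
  \<open>t\<close>, and \<open>c0\<close> from \<open>\<delta>\<close>. The bound \<open>M\<close>,
  known in advance, is what keeps \<open>t\<close> independent of \<open>c0\<close>.\<close>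

lemma bounded_near_maximisers_imp_wijsman_bound:
  fixes C0 :: "'y::real_normed_vector set"
  assumes D: "((\<lambda>y. (norm y)\<^sup>2) has_derivative \<phi>) (at u)"
    and le: "\<And>c. c \<in> C0 \<Longrightarrow> \<phi> c \<le> \<sigma>"
    and near: "\<And>\<delta>. \<delta> > 0 \<Longrightarrow> \<exists>c\<in>C0. norm c \<le> M \<and> \<phi> c > \<sigma> - \<delta>"
    and wij: "wijsman_converges C C0 F"
    and conv: "\<forall>\<^sub>F \<alpha> in F. convex (C \<alpha>)"
    and \<epsilon>: "\<epsilon> > 0"
  shows "\<forall>\<^sub>F \<alpha> in F. \<forall>c\<in>C \<alpha>. norm c \<le> K \<longrightarrow> \<phi> c < \<sigma> + \<epsilon>"
proof -
  have lin: "linear \<phi>"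
    using D has_derivative_linear by blast
  note lins = linear_add[OF lin] linear_diff[OF lin] linear_scale[OF lin] linear_neg[OF lin]
  \<comment> \<open>The added 1 makes room for the error \<open>\<gamma> \<le> t\<close> in
    \<open>norm h \<le> t * (K' - 1) + \<gamma>\<close>.\<close>
  define K' where "K' = max K 0 + max M 0 + 1"
  have K': "K' > 0"
    by (simp add: K'_def add_nonneg_pos)
  define \<eta> where "\<eta> = \<epsilon> / (4 * K')"
  have \<eta>: "\<eta> > 0"
    using \<epsilon> K' by (simp add: \<eta>_def)
  obtain \<rho> where \<rho>: "\<rho> > 0" and
    \<rho>': "\<And>y. norm (y - u) < \<rho> \<Longrightarrow>
      norm ((norm y)\<^sup>2 - (norm u)\<^sup>2 - \<phi> (y - u)) \<le> \<eta> * norm (y - u)"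
    using D \<eta> unfolding has_derivative_at_alt by blast
  obtain B where B: "B > 0" and B': "\<And>h. norm (\<phi> h) \<le> norm h * B"
    using bounded_linear.pos_bounded[OF has_derivative_bounded_linear[OF D]] by blast
  define t where "t = min (1/2) (\<rho> / (2 * K'))"
  have t: "t > 0" "t < 1"
    using \<rho> K' by (auto simp: t_def)
  have "t * K' \<le> \<rho> / (2 * K') * K'"
    using K' by (intro mult_right_mono) (auto simp: t_def)
  also have "\<dots> < \<rho>"
    using \<rho> K' by simp
  finally have t\<rho>: "t * K' < \<rho>" .
  define \<gamma> where "\<gamma> = min t (t * \<epsilon> / (4 * B))"
  have \<gamma>: "\<gamma> > 0" "\<gamma> \<le> t" and \<gamma>B: "\<gamma> * B \<le> t * \<epsilon> / 4"
  proof -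
    show "\<gamma> > 0" "\<gamma> \<le> t"
      using t \<epsilon> B by (auto simp: \<gamma>_def)
    have "\<gamma> * B \<le> t * \<epsilon> / (4 * B) * B"
      using B by (intro mult_right_mono) (auto simp: \<gamma>_def)
    then show "\<gamma> * B \<le> t * \<epsilon> / 4"
      using B by simp
  qed
  \<comment> \<open>Budget: a violating \<open>c\<close> lowers the squared distance by
    \<open>t * \<epsilon>\<close>. A quarter is lost to replacing \<open>c0\<close> by a nearby
    point of \<open>C \<alpha>\<close>, a quarter to the Frechet remainder, and the remaining half
    equals \<open>2 * \<delta>\<close>.\<close>
  define \<delta> where "\<delta> = t * \<epsilon> / 4"
  have \<delta>: "\<delta> > 0"
    using t \<epsilon> by (simp add: \<delta>_def)
  obtain c0 where c0: "c0 \<in> C0" "norm c0 \<le> M" "\<phi> c0 > \<sigma> - \<delta>"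
    using near[OF \<delta>] by blast
  define y where "y = c0 + u"
  \<comment> \<open>The argument of \<open>sqrt\<close> may be negative; \<open>sqrt\<close> is odd
    and strictly increasing on all reals, so no case split arises.\<close>
  have "ereal (sqrt ((norm u)\<^sup>2 - \<delta>)) \<le> pt_dist y C0"
    unfolding pt_dist_def
  proof (rule INF_greatest)
    fix c assume "c \<in> C0"
    have "(norm (u + (c0 - c)))\<^sup>2 \<ge> (norm u)\<^sup>2 + \<phi> (c0 - c)"
      by (rule norm_sq_above_tangent[OF D])
    moreover have "\<phi> (c0 - c) \<ge> - \<delta>"
      using le[OF \<open>c \<in> C0\<close>] c0(3) by (simp add: lins)
    moreover have "u + (c0 - c) = y - c"
      by (simp add: y_def)
    ultimately have "(norm u)\<^sup>2 - \<delta> \<le> (norm (y - c))\<^sup>2"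
      by simp
    then have "sqrt ((norm u)\<^sup>2 - \<delta>) \<le> sqrt ((norm (y - c))\<^sup>2)"
      by (rule real_sqrt_le_mono)
    then show "ereal (sqrt ((norm u)\<^sup>2 - \<delta>)) \<le> ereal (norm (y - c))"
      by simp
  qed
  \<comment> \<open>Passing from \<open>\<delta>\<close> to \<open>2 * \<delta>\<close> makes the
    inequality strict, hence stable along the net.\<close>
  then have "ereal (sqrt ((norm u)\<^sup>2 - 2 * \<delta>)) < pt_dist y C0"
    by (rule less_le_trans[rotated]) (use \<delta> in simp)
  then have ev1: "\<forall>\<^sub>F \<alpha> in F. ereal (sqrt ((norm u)\<^sup>2 - 2 * \<delta>)) < pt_dist y (C \<alpha>)"
    using wij unfolding wijsman_converges_def by (blast dest: order_tendstoD(1))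
  have "pt_dist c0 C0 \<le> ereal (norm (c0 - c0))"
    unfolding pt_dist_def using c0(1) by (rule INF_lower)
  then have "pt_dist c0 C0 < ereal \<gamma>"
    using \<gamma>(1) by (simp add: le_less_trans)
  then have ev2: "\<forall>\<^sub>F \<alpha> in F. pt_dist c0 (C \<alpha>) < ereal \<gamma>"
    using wij unfolding wijsman_converges_def by (blast dest: order_tendstoD(2))
  show ?thesis
    using ev1 ev2 conv
  proof eventually_elim
    case (elim \<alpha>)
    show ?case
    proof (intro ballI impI, rule ccontr)
      fix c assume c: "c \<in> C \<alpha>" "norm c \<le> K" and neg: "\<not> \<phi> c < \<sigma> + \<epsilon>"
      obtain c' where c': "c' \<in> C \<alpha>" "norm (c0 - c') < \<gamma>"
        using elim(2) unfolding pt_dist_def INF_less_iff by auto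
      define z where "z = (1 - t) *\<^sub>R c' + t *\<^sub>R c"
      have "z \<in> C \<alpha>"
        unfolding z_def using elim(3) c(1) c'(1) t by (intro convexD) auto
      then have "pt_dist y (C \<alpha>) \<le> ereal (norm (y - z))"
        unfolding pt_dist_def by (rule INF_lower)
      with elim(1) have "ereal (sqrt ((norm u)\<^sup>2 - 2 * \<delta>)) < ereal (norm (y - z))"
        by (rule less_le_trans)
      then have "sqrt ((norm u)\<^sup>2 - 2 * \<delta>) < sqrt ((norm (y - z))\<^sup>2)"
        by simp
      then have far: "(norm u)\<^sup>2 - 2 * \<delta> < (norm (y - z))\<^sup>2"
        by (simp only: real_sqrt_less_iff)
      define h where "h = t *\<^sub>R (c0 - c) + (1 - t) *\<^sub>R (c0 - c')"
      have yz: "y - z - u = h"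
        by (simp add: h_def y_def z_def algebra_simps)
      have n1: "norm ((1 - t) *\<^sub>R (c0 - c')) \<le> \<gamma>"
      proof -
        have "(1 - t) * norm (c0 - c') \<le> 1 * norm (c0 - c')"
          using t by (intro mult_right_mono) auto
        then show ?thesis
          using c'(2) t by simp
      qed
      have "norm (c0 - c) \<le> K' - 1"
        using norm_triangle_ineq4[of c0 c] c0(2) c(2) by (simp add: K'_def)
      then have "t * norm (c0 - c) \<le> t * (K' - 1)"
        using t by simp
      then have "norm (t *\<^sub>R (c0 - c)) \<le> t * K' - t"
        using t by (simp add: right_diff_distrib)
      then have nh: "norm h \<le> t * K'"
        using n1 \<gamma>(2) norm_triangle_ineq[of "t *\<^sub>R (c0 - c)" "(1 - t) *\<^sub>R (c0 - c')"]
        unfolding h_def by linarith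
      have "\<eta> * norm h \<le> \<eta> * (t * K')"
        using nh \<eta> by simp
      also have "\<dots> = t * \<epsilon> / 4"
        using K' by (simp add: \<eta>_def)
      finally have \<eta>h: "\<eta> * norm h \<le> t * \<epsilon> / 4" .
      have "\<phi> ((1 - t) *\<^sub>R (c0 - c')) \<le> \<gamma> * B"
      proof -
        have "\<phi> ((1 - t) *\<^sub>R (c0 - c')) \<le> norm ((1 - t) *\<^sub>R (c0 - c')) * B"
          using B'[of "(1 - t) *\<^sub>R (c0 - c')"] by simp
        also have "\<dots> \<le> \<gamma> * B"
          using n1 B by (intro mult_right_mono) auto
        finally show ?thesis .
      qed
      moreover have "\<phi> (t *\<^sub>R (c0 - c)) \<le> - (t * \<epsilon>)"
      proof -
        have "\<phi> c0 - \<phi> c \<le> - \<epsilon>"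
          using le[OF c0(1)] neg by simp
        then have "t * (\<phi> c0 - \<phi> c) \<le> t * (- \<epsilon>)"
          using t by (intro mult_left_mono) auto
        then show ?thesis
          by (simp add: lins)
      qed
      ultimately have \<phi>h: "\<phi> h \<le> - (t * \<epsilon>) + t * \<epsilon> / 4"
        using \<gamma>B linear_add[OF lin, of "t *\<^sub>R (c0 - c)" "(1 - t) *\<^sub>R (c0 - c')"]
        unfolding h_def by linarith
      have "norm ((norm (y - z))\<^sup>2 - (norm u)\<^sup>2 - \<phi> h) \<le> \<eta> * norm h"
        using \<rho>'[of "y - z"] nh t\<rho> unfolding yz by linarith
      then have "(norm (y - z))\<^sup>2 \<le> (norm u)\<^sup>2 + \<phi> h + \<eta> * norm h"
        unfolding real_norm_def by linarith
      then show False
        using far \<phi>h \<eta>h unfolding \<delta>_def by linarith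
    qed
  qed
qed

section \<open>Differentiability of the squared norm on the product\<close>

text \<open>Squaring removes the kink at the origin: the remainder there is
  \<open>(norm y)\<^sup>2\<close>, at most \<open>e * norm y\<close> once
  \<open>norm y < e\<close>.\<close>

lemma norm_sq_differentiable:
  fixes x :: "'a::real_normed_vector"
  assumes "frechet_differentiable_norm TYPE('a)"
  shows "(\<lambda>y::'a. (norm y)\<^sup>2) differentiable (at x)"
proof (cases "x = 0")
  case False
  then have "norm differentiable (at x)"
    using assms by (simp add: frechet_differentiable_norm_def)
  then show ?thesis
    by (rule differentiable_power)
next
  case True
  have "((\<lambda>y::'a. (norm y)\<^sup>2) has_derivative (\<lambda>_. 0)) (at 0)"
    unfolding has_derivative_at_alt
  proof (intro conjI allI impI)
    fix e :: real assume "e > 0"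
    then show "\<exists>d>0. \<forall>y::'a. norm (y - 0) < d \<longrightarrow>
        norm ((norm y)\<^sup>2 - (norm (0::'a))\<^sup>2 - 0) \<le> e * norm (y - 0)"
      by (intro exI[of _ e]) (auto simp: power2_eq_square intro: mult_right_mono)
  qed simp
  then show ?thesis
    using True by (auto simp: differentiable_def)
qed

lemma norm_sq_differentiable_prod:
  fixes v :: "'a::real_normed_vector \<times> real"
  assumes "frechet_differentiable_norm TYPE('a)"
  shows "(\<lambda>y::'a \<times> real. (norm y)\<^sup>2) differentiable (at v)"
proof -
  obtain D where D: "((\<lambda>y::'a. (norm y)\<^sup>2) has_derivative D) (at (fst v))"
    using norm_sq_differentiable[OF assms] by (auto simp: differentiable_def)
  have "((\<lambda>y::'a \<times> real. (norm (fst y))\<^sup>2) has_derivative (\<lambda>h. D (fst h))) (at v)"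
    by (rule has_derivative_compose[where f = fst and g = "\<lambda>y. (norm y)\<^sup>2", OF _ D])
       (auto intro!: derivative_eq_intros)
  moreover have "(\<lambda>y::'a \<times> real. (snd y)\<^sup>2) differentiable (at v)"
    by (intro differentiable_power)
       (auto simp: differentiable_def intro!: has_derivative_snd has_derivative_ident)
  ultimately have "(\<lambda>y::'a \<times> real. (norm (fst y))\<^sup>2 + (snd y)\<^sup>2) differentiable (at v)"
    by (intro differentiable_add) (auto simp: differentiable_def)
  then show ?thesis
    by (simp add: norm_prod_def)
qed

text \<open>Complete the square in the last coordinate: a shift of the base point there adds a
  linear term and a constant. The tilted functional is thus again a derivative of the squared
  norm.\<close>

lemma norm_sq_derivative_tilt:
  fixes v :: "'a::real_normed_vector \<times> real"
  assumes D: "((\<lambda>y::'a \<times> real. (norm y)\<^sup>2) has_derivative D) (at v)"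
  shows "((\<lambda>y::'a \<times> real. (norm y)\<^sup>2) has_derivative (\<lambda>h. D h - \<kappa> * snd h)) (at (v - (0, \<kappa> / 2)))"
proof -
  have eq: "(norm y)\<^sup>2 = (norm (y + (0, \<kappa> / 2)))\<^sup>2 - \<kappa> * snd y - \<kappa>\<^sup>2 / 4" for y :: "'a \<times> real"
    by (simp add: norm_prod_def) (simp add: power2_eq_square algebra_simps)
  have "((\<lambda>y. (norm (y + (0, \<kappa> / 2)))\<^sup>2) has_derivative (\<lambda>h. D h)) (at (v - (0, \<kappa> / 2)))"
    using D by (intro has_derivative_compose[where f = "\<lambda>y. y + (0, \<kappa> / 2)" and g = "\<lambda>y. (norm y)\<^sup>2"])
       (auto intro!: derivative_eq_intros)
  then have "((\<lambda>y. (norm (y + (0, \<kappa> / 2)))\<^sup>2 - \<kappa> * snd y - \<kappa>\<^sup>2 / 4) has_derivative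
      (\<lambda>h. D h - \<kappa> * snd h - 0)) (at (v - (0, \<kappa> / 2)))"
    by (intro has_derivative_diff has_derivative_mult_right has_derivative_snd
        has_derivative_ident has_derivative_const)
  then show ?thesis
    by (simp only: eq[symmetric] diff_zero)
qed

section \<open>Separation by derivatives of the squared norm\<close>

text \<open>A plain Hahn-Banach functional would not do, since the functional must be a derivative
  of the squared norm. At a point of least norm in the closure of \<open>W - C\<close> the
  derivative would separate exactly; such a point may not exist, and Ekeland's substitute costs the
  term with \<open>e\<close>. The bound on \<open>norm v\<close> does not involve \<open>e\<close>,
  so \<open>e\<close> may be chosen in terms of it.\<close>

lemma approximate_separation:
  fixes W C :: "'y::banach set"
  assumes diff: "\<And>v::'y. (\<lambda>y. (norm y)\<^sup>2) differentiable (at v)"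
    and conv: "convex W" "convex C" and w1: "w1 \<in> W" and c1: "c1 \<in> C"
    and d: "\<And>w c. w \<in> W \<Longrightarrow> c \<in> C \<Longrightarrow> d \<le> norm (w - c)" and e: "e > 0"
  obtains v D where "((\<lambda>y. (norm y)\<^sup>2) has_derivative D) (at v)"
    "norm v \<le> norm (w1 - c1)" "d \<le> norm v"
    "\<And>w c. w \<in> W \<Longrightarrow> c \<in> C \<Longrightarrow> D (w - c) \<ge> 2 * (norm v)\<^sup>2 - e * norm (w - c - v)"
proof -
  define K0 where "K0 = (\<Union>w\<in>W. \<Union>c\<in>C. {w - c})"
  define K where "K = closure K0"
  have "convex K"
    unfolding K_def K0_def by (intro convex_closure convex_differences conv)
  have in_K: "w - c \<in> K" if "w \<in> W" "c \<in> C" for w c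
    using that closure_subset[of K0] by (auto simp: K_def K0_def)
  have K_ge: "d \<le> norm v" if "v \<in> K" for v
  proof -
    have "closed {v. d \<le> norm (v::'y)}"
      by (intro closed_Collect_le continuous_intros)
    moreover have "K0 \<subseteq> {v. d \<le> norm v}"
      using d by (auto simp: K0_def)
    ultimately have "K \<subseteq> {v. d \<le> norm v}"
      unfolding K_def by (rule closure_minimal[rotated])
    then show ?thesis
      using that by blast
  qed
  obtain v where v: "v \<in> K" "(norm v)\<^sup>2 \<le> (norm (w1 - c1))\<^sup>2"
    "\<And>y. y \<in> K \<Longrightarrow> (norm y)\<^sup>2 \<ge> (norm v)\<^sup>2 - e * norm (y - v)"
    by (rule ekeland[of K "\<lambda>y. (norm y)\<^sup>2", OF _ _ _ in_K[OF w1 c1] e])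
       (auto simp: K_def intro!: continuous_intros)
  obtain D where D: "((\<lambda>y. (norm y)\<^sup>2) has_derivative D) (at v)"
    using diff by (auto simp: differentiable_def)
  have lin: "linear D"
    using D has_derivative_linear by blast
  have dir: "D (y - v) \<ge> - e * norm (y - v)" if "y \<in> K" for y
  proof (rule tendsto_lowerbound[OF has_derivative_imp_directional[OF D]])
    have "\<forall>\<^sub>F t in at_right (0::real). t \<in> {0<..<1}"
      by (rule eventually_at_right_real) simp
    then show "\<forall>\<^sub>F t in at_right 0.
        - e * norm (y - v) \<le> ((norm (v + t *\<^sub>R (y - v)))\<^sup>2 - (norm v)\<^sup>2) / t"
    proof eventually_elim
      case (elim t)
      have "(1 - t) *\<^sub>R v + t *\<^sub>R y \<in> K"
        using \<open>convex K\<close> v(1) that elim by (intro convexD) auto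
      then have "v + t *\<^sub>R (y - v) \<in> K"
        by (simp add: algebra_simps)
      from v(3)[OF this] show ?case
        using elim by (simp add: pos_le_divide_eq) (simp add: algebra_simps)
    qed
  qed simp
  show thesis
  proof
    show "norm v \<le> norm (w1 - c1)"
      using v(2) by (rule power2_le_imp_le) simp
    show "d \<le> norm v"
      using K_ge v(1) .
    show "D (w - c) \<ge> 2 * (norm v)\<^sup>2 - e * norm (w - c - v)" if "w \<in> W" "c \<in> C" for w c
      using dir[OF in_K[OF that]] norm_sq_derivative_self[OF D] linear_diff[OF lin, of "w - c" v]
      by simp
  qed (rule D)
qed

text \<open>A pair in \<open>W\<close> and \<open>C \<alpha>\<close> at distance at most
  \<open>d - \<eta>\<close> would force \<open>\<phi> c \<ge> \<sigma> + d * \<eta>\<close> at a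
  point of norm at most \<open>M + d\<close>, which the functional bound eventually
  excludes.\<close>

lemma wijsman_imp_gap_lower_bound:
  fixes C0 :: "('a::banach \<times> real) set"
  assumes fr: "frechet_differentiable_norm TYPE('a)"
    and W: "convex W" "W \<noteq> {}" "bounded W"
    and C0: "convex C0" "C0 \<noteq> {}" and coer: "\<And>x s. (x, s) \<in> C0 \<Longrightarrow> norm x \<le> s + B"
    and wij: "wijsman_converges C C0 F"
    and conv: "\<forall>\<^sub>F \<alpha> in F. convex (C \<alpha>)"
    and dW: "\<And>w c. w \<in> W \<Longrightarrow> c \<in> C0 \<Longrightarrow> d \<le> norm (w - c)" and d: "d > 0" and \<eta>: "\<eta> > 0"
  shows "\<forall>\<^sub>F \<alpha> in F. \<forall>w\<in>W. \<forall>c\<in>C \<alpha>. norm (w - c) > d - \<eta>"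
proof -
  obtain M where M: "M > 0" "\<And>w. w \<in> W \<Longrightarrow> norm w \<le> M"
    using W(3) unfolding bounded_pos by blast
  obtain w1 c1 where w1: "w1 \<in> W" and c1: "c1 \<in> C0"
    using W(2) C0(2) by blast
  define L where "L = norm (w1 - c1)"
  define B' where "B' = max B 0"
  have B': "B' \<ge> 0" and coer': "\<And>x s. (x, s) \<in> C0 \<Longrightarrow> norm x \<le> s + B'"
    using coer by (force simp: B'_def)+
  \<comment> \<open>\<open>\<kappa> * A1\<close> bounds the total error in \<open>up'\<close>: the
    constant from \<open>up\<close> plus \<open>\<kappa> / 2 * B'\<close>, as the last coordinate is
    at least \<open>- B'\<close> on \<open>C0\<close>. \<open>A\<close> also covers the tilt at
    points of norm at most \<open>M + d\<close>. Neither depends on \<open>v\<close>, so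
    \<open>\<kappa>\<close> can be fixed first.\<close>
  define A1 where "A1 = (M + L + 5 * B') / 4"
  have A1: "A1 \<ge> 0"
    using M(1) B' by (simp add: A1_def L_def)
  define A where "A = A1 + M + d"
  have A: "A > 0"
    using A1 M(1) d by (simp add: A_def)
  define \<kappa> where "\<kappa> = d * \<eta> / A"
  have \<kappa>: "\<kappa> > 0" and \<kappa>A: "\<kappa> * A = d * \<eta>"
    using d \<eta> A by (simp_all add: \<kappa>_def)
  have \<kappa>4: "\<kappa> / 4 > 0"
    using \<kappa> by simp
  obtain v D where D: "((\<lambda>y. (norm y)\<^sup>2) has_derivative D) (at v)"
    and vL: "norm v \<le> L" and dv: "d \<le> norm v"
    and sep: "\<And>w c. w \<in> W \<Longrightarrow> c \<in> C0 \<Longrightarrow> D (w - c) \<ge> 2 * (norm v)\<^sup>2 - \<kappa> / 4 * norm (w - c - v)"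
    by (rule approximate_separation[OF norm_sq_differentiable_prod[OF fr] W(1) C0(1) w1 c1 dW \<kappa>4,
          folded L_def]) (assumption | rule that)+
  have lin: "linear D"
    using D has_derivative_linear by blast
  define \<phi> where "\<phi> h = D h - \<kappa> * snd h" for h
  have D\<phi>: "((\<lambda>y. (norm y)\<^sup>2) has_derivative \<phi>) (at (v - (0, \<kappa> / 2)))"
    unfolding \<phi>_def[abs_def] by (rule norm_sq_derivative_tilt[OF D])
  \<comment> \<open>On \<open>C0\<close> the norm of \<open>(x, s)\<close> is at most
    \<open>2 * s + 3 * B'\<close>, so the Ekeland error with factor \<open>\<kappa> / 4\<close>
    grows like \<open>\<kappa> / 2 * s\<close>. The tilt \<open>- \<kappa> * s\<close> absorbs it
    and leaves \<open>- \<kappa> / 2 * s\<close>, which confines near-maximisers.\<close>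
  have up: "\<phi> c \<le> D w - 2 * (norm v)\<^sup>2 + \<kappa> * ((M + L + 3 * B') / 4) - \<kappa> / 2 * snd c"
    if "w \<in> W" "c \<in> C0" for w c
  proof -
    obtain x s where c: "c = (x, s)" by (cases c)
    have xs: "norm x \<le> s + B'"
      using coer' that(2) c by simp
    then have "- B' \<le> s"
      using norm_ge_zero[of x] by linarith
    then have "\<bar>s\<bar> \<le> s + 2 * B'"
      using B' by linarith
    moreover have "norm c \<le> norm x + \<bar>s\<bar>"
      unfolding c by (simp add: norm_prod_def sqrt_sum_squares_le_sum_abs[of "norm x" s, simplified])
    ultimately have "norm c \<le> 2 * s + 3 * B'"
      using xs by linarith
    then have "norm (w - c - v) \<le> M + L + 3 * B' + 2 * s"
      using norm_triangle_ineq4[of "w - c" v] norm_triangle_ineq4[of w c] M(2)[OF that(1)] vL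
      by linarith
    then have "\<kappa> / 4 * norm (w - c - v) \<le> \<kappa> / 4 * (M + L + 3 * B' + 2 * s)"
      using \<kappa> by (intro mult_left_mono) auto
    then have "D c \<le> D w - 2 * (norm v)\<^sup>2 + \<kappa> / 4 * (M + L + 3 * B' + 2 * s)"
      using sep[OF that] by (simp add: linear_diff[OF lin])
    then show ?thesis
      unfolding \<phi>_def c by (simp add: algebra_simps add_divide_distrib)
  qed
  have snd_ge: "snd c \<ge> - B'" if "c \<in> C0" for c
  proof -
    have "norm (fst c) \<le> snd c + B'"
      using coer'[of "fst c" "snd c"] that by simp
    then show ?thesis
      using norm_ge_zero[of "fst c"] by linarith
  qed
  have up': "\<phi> c \<le> D w - 2 * (norm v)\<^sup>2 + \<kappa> * A1" if "w \<in> W" "c \<in> C0" for w c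
  proof -
    have "\<kappa> / 2 * (- B') \<le> \<kappa> / 2 * snd c"
      using snd_ge[OF that(2)] \<kappa> by (intro mult_left_mono) auto
    then show ?thesis
      using up[OF that] unfolding A1_def by (simp add: algebra_simps add_divide_distrib)
  qed
  define \<sigma> where "\<sigma> = Sup (\<phi> ` C0)"
  have bdd: "bdd_above (\<phi> ` C0)"
    using up'[OF w1] by (intro bdd_aboveI2)
  have le: "\<phi> c \<le> \<sigma>" if "c \<in> C0" for c
    unfolding \<sigma>_def using that bdd by (intro cSup_upper) auto
  have \<sigma>_le: "\<sigma> \<le> D w - 2 * (norm v)\<^sup>2 + \<kappa> * A1" if "w \<in> W" for w
    unfolding \<sigma>_def using C0(2) up'[OF that] by (intro cSup_least) auto
  define A2 where "A2 = D w1 - 2 * (norm v)\<^sup>2 + \<kappa> * ((M + L + 3 * B') / 4)"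
  define R where "R = 2 * (A2 - \<sigma> + 1) / \<kappa>"
  have near: "\<exists>c\<in>C0. norm c \<le> 2 * R + 3 * B' \<and> \<phi> c > \<sigma> - \<delta>" if "\<delta> > 0" for \<delta>
  proof -
    \<comment> \<open>Capping the tolerance at 1 keeps the radius \<open>R\<close> independent of
      \<open>\<delta>\<close>.\<close>
    have "\<sigma> - min \<delta> 1 < Sup (\<phi> ` C0)"
      using that by (simp add: \<sigma>_def)
    then obtain c where c: "c \<in> C0" "\<sigma> - min \<delta> 1 < \<phi> c"
      using C0(2) less_cSupD[of "\<phi> ` C0"] by blast
    have "\<kappa> / 2 * snd c \<le> A2 - \<sigma> + 1"
      using up[OF w1 c(1)] c(2) unfolding A2_def by linarith
    then have R: "snd c \<le> R"
      using \<kappa> by (simp add: R_def field_simps)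
    have x: "norm (fst c) \<le> snd c + B'"
      using coer'[of "fst c" "snd c"] c(1) by simp
    have "norm c \<le> norm (fst c) + \<bar>snd c\<bar>"
      using sqrt_sum_squares_le_sum_abs[of "norm (fst c)" "snd c"] by (simp add: norm_prod_def)
    then have "norm c \<le> 2 * R + 3 * B'"
      using R x snd_ge[OF c(1)] B' by linarith
    then show ?thesis
      using c by auto
  qed
  have "d * \<eta> > 0"
    using d \<eta> by simp
  then have "\<forall>\<^sub>F \<alpha> in F. \<forall>c\<in>C \<alpha>. norm c \<le> M + d \<longrightarrow> \<phi> c < \<sigma> + d * \<eta>"
    by (intro bounded_near_maximisers_imp_wijsman_bound[OF D\<phi> le near wij conv])
  then show ?thesis
  proof eventually_elim
    case (elim \<alpha>)
    show ?case
    proof (intro ballI, rule ccontr)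
      fix w c assume w: "w \<in> W" and c: "c \<in> C \<alpha>" and "\<not> norm (w - c) > d - \<eta>"
      then have wc: "norm (w - c) \<le> d - \<eta>"
        by simp
      have nc: "norm c \<le> M + d"
        using norm_triangle_ineq2[of c w] M(2)[OF w] wc \<eta> by (simp add: norm_minus_commute)
      have "D (w - c) \<le> 2 * norm v * norm (w - c)"
        by (rule norm_sq_derivative_le[OF D])
      also have "\<dots> \<le> 2 * norm v * (d - \<eta>)"
        using wc by (intro mult_left_mono) auto
      finally have 1: "D w - D c \<le> 2 * norm v * (d - \<eta>)"
        by (simp add: linear_diff[OF lin])
      have "snd c \<le> M + d"
        using norm_snd_le[of "snd c" "fst c"] nc by simp
      then have 2: "\<kappa> * snd c \<le> \<kappa> * (M + d)"
        using \<kappa> by (intro mult_left_mono) auto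
      \<comment> \<open>As \<open>d \<le> norm v\<close>, being too close gains at least
        \<open>2 * (d * \<eta>)\<close>; half pays for the errors \<open>\<kappa> * A\<close>, half
        exceeds the bound on \<open>\<phi>\<close>.\<close>
      have "d * \<eta> \<le> norm v * (norm v - d + \<eta>)"
        using d dv \<eta> by (intro mult_mono) auto
      then have 3: "2 * (d * \<eta>) \<le> 2 * (norm v)\<^sup>2 - 2 * norm v * (d - \<eta>)"
        by (simp add: power2_eq_square algebra_simps)
      have 4: "\<kappa> * A1 + \<kappa> * (M + d) = d * \<eta>"
        using \<kappa>A by (simp add: A_def algebra_simps)
      have "\<phi> c \<ge> \<sigma> + d * \<eta>"
        using 1 2 3 4 \<sigma>_le[OF w] unfolding \<phi>_def by linarith
      then show False
        using elim c nc by fastforce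
    qed
  qed
qed

section \<open>Epigraphs and coercivity\<close>

lemma convex_epi:
  assumes "convex_fun g"
  shows "convex (epi g)"
  unfolding convex_alt
proof (intro ballI allI impI)
  fix p q :: "'a \<times> real" and t :: real
  assume pq: "p \<in> epi g" "q \<in> epi g" and t: "0 \<le> t \<and> t \<le> 1"
  obtain x a y b where p: "p = (x, a)" and q: "q = (y, b)"
    by (metis surj_pair)
  show "(1 - t) *\<^sub>R p + t *\<^sub>R q \<in> epi g"
  proof (cases "0 < t \<and> t < 1")
    case True
    then have "g ((1 - t) *\<^sub>R x + t *\<^sub>R y) \<le> ereal (1 - t) * g x + ereal t * g y"
      using assms by (simp add: convex_fun_def)
    also have "\<dots> \<le> ereal (1 - t) * ereal a + ereal t * ereal b"
      using pq True unfolding p q epi_def by (intro add_mono ereal_mult_left_mono) auto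
    finally show ?thesis
      by (simp add: p q epi_def)
  next
    case False
    then have "t = 0 \<or> t = 1"
      using t by auto
    then show ?thesis
      using pq by auto
  qed
qed

text \<open>Semicontinuity bounds \<open>f\<close> below by \<open>b\<close> near \<open>x0\<close>.
  A very low value at \<open>x\<close> would, by convexity, pull \<open>f\<close> under
  \<open>b\<close> at the point \<open>y\<close> of the segment that lies close to
  \<open>x0\<close>; one weight \<open>s\<close> serves the whole ball.\<close>

lemma convex_lsc_bounded_below_on_cball:
  fixes f :: "'a::real_normed_vector \<Rightarrow> ereal"
  assumes nm: "never_minus_infinity f" and cv: "convex_fun f" and lsc: "lsc_fun f"
    and x0: "f x0 \<le> ereal a"
  obtains m where "\<And>x. norm x \<le> R \<Longrightarrow> f x \<ge> ereal m"
proof -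
  have "- \<infinity> < f x0"
    using nm by (simp add: never_minus_infinity_def)
  then obtain b where b: "ereal b < f x0"
    using ereal_dense2 by blast
  then have "\<forall>\<^sub>F x in at x0. ereal b < f x"
    using lsc unfolding lsc_fun_def le_Liminf_iff by blast
  \<comment> \<open>The filter \<open>at x0\<close> omits \<open>x0\<close> itself, which the choice
    of \<open>b\<close> covers.\<close>
  then obtain \<rho> where \<rho>: "\<rho> > 0" "\<And>y. dist y x0 < \<rho> \<Longrightarrow> ereal b < f y"
    using b unfolding eventually_at by (metis UNIV_I)
  define N where "N = \<bar>R\<bar> + norm x0 + \<rho>"
  define s where "s = \<rho> / (2 * N)"
  have N: "N > 0" "\<rho> \<le> N"
    using \<rho>(1) by (auto simp: N_def intro: add_nonneg_pos)
  have s: "0 < s" "s < 1"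
    using N \<rho>(1) by (auto simp: s_def divide_less_eq)
  have "f x \<ge> ereal ((b - (1 - s) * a) / s)" if "norm x \<le> R" for x
  proof (cases "f x")
    case (real q)
    define y where "y = (1 - s) *\<^sub>R x0 + s *\<^sub>R x"
    have "norm (x - x0) \<le> N"
      using norm_triangle_ineq4[of x x0] that \<rho>(1) unfolding N_def by linarith
    then have "s * norm (x - x0) \<le> s * N"
      using s by simp
    also have "\<dots> < \<rho>"
      using N \<rho>(1) by (simp add: s_def)
    finally have "norm (s *\<^sub>R (x - x0)) < \<rho>"
      using s by simp
    moreover have "y - x0 = s *\<^sub>R (x - x0)"
      by (simp add: y_def algebra_simps)
    ultimately have "ereal b < f y"
      using \<rho>(2) by (simp add: dist_norm)
    also have "\<dots> \<le> ereal (1 - s) * f x0 + ereal s * f x"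
      using cv s by (simp add: convex_fun_def y_def)
    also have "\<dots> \<le> ereal (1 - s) * ereal a + ereal s * ereal q"
      using x0 s real by (intro add_mono ereal_mult_left_mono) auto
    finally have "b < (1 - s) * a + s * q"
      by simp
    then show ?thesis
      using s real by (simp add: divide_le_eq algebra_simps)
  qed (use nm in \<open>auto simp: never_minus_infinity_def\<close>)
  then show thesis
    using that by blast
qed

text \<open>Far out, growth gives \<open>norm x < s\<close>; on the remaining ball \<open>s\<close>
  is bounded below. The radius \<open>max R 1\<close> keeps the divisor positive.\<close>

lemma superlinear_imp_norm_bound:
  fixes f :: "'a::real_normed_vector \<Rightarrow> ereal"
  assumes "never_minus_infinity f" "convex_fun f" "lsc_fun f"
    and lim: "((\<lambda>x. f x / ereal (norm x)) \<longlongrightarrow> \<infinity>) at_infinity"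
  obtains B where "\<And>x s. (x, s) \<in> epi f \<Longrightarrow> norm x \<le> s + B"
proof (cases "epi f = {}")
  case True
  then show ?thesis
    using that by simp
next
  case False
  then obtain x0 a where x0: "f x0 \<le> ereal a"
    by (auto simp: epi_def)
  have "\<forall>\<^sub>F x in at_infinity. f x / ereal (norm x) > ereal 1"
    using lim by (auto intro: order_tendstoD(1))
  then obtain R where R: "\<And>x. norm x \<ge> R \<Longrightarrow> f x / ereal (norm x) > ereal 1"
    unfolding eventually_at_infinity by blast
  obtain m where m: "\<And>x. norm x \<le> max R 1 \<Longrightarrow> f x \<ge> ereal m"
    using convex_lsc_bounded_below_on_cball[OF assms(1-3) x0] by blast
  show thesis
  proof
    fix x s assume "(x, s) \<in> epi f"
    then have fs: "f x \<le> ereal s"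
      by (simp add: epi_def)
    show "norm x \<le> s + (\<bar>m\<bar> + max R 1)"
    proof (cases "norm x \<le> max R 1")
      case True
      then have "m \<le> s"
        using m fs by (metis ereal_less_eq(3) order_trans)
      then show ?thesis
        using True by linarith
    next
      case False
      then have pos: "norm x > 0" and "norm x \<ge> R"
        by linarith+
      then have "ereal 1 < f x / ereal (norm x)"
        using R by blast
      also have "\<dots> \<le> ereal s / ereal (norm x)"
        using fs pos by (intro ereal_divide_right_mono) auto
      finally have "1 < s / norm x"
        using pos by simp
      then have "norm x < s"
        using pos by (simp add: less_divide_eq)
      then show ?thesis
        using False by linarith
    qed
  qed
qed

section \<open>Slice convergence\<close>

text \<open>An empty limit offers no point to separate from. Instead, the distance from one point of
  \<open>W\<close> exceeds the gap by at most \<open>2 * M\<close>, a bound on the diameter of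
  \<open>W\<close>.\<close>

lemma wijsman_empty_imp_gap_tendsto_PInfty:
  assumes wij: "wijsman_converges C {} F" and W: "bounded W"
  shows "((\<lambda>\<alpha>. gap_dist W (C \<alpha>)) \<longlongrightarrow> \<infinity>) F"
proof (cases "W = {}")
  case True
  then show ?thesis
    by (simp add: gap_dist_def top_ereal_def)
next
  case False
  then obtain w1 where w1: "w1 \<in> W"
    by blast
  obtain M where M: "\<And>w. w \<in> W \<Longrightarrow> norm w \<le> M"
    using W unfolding bounded_iff by blast
  have lim: "((\<lambda>\<alpha>. pt_dist w1 (C \<alpha>)) \<longlongrightarrow> \<infinity>) F"
    using wij unfolding wijsman_converges_def by (simp add: pt_dist_def top_ereal_def)
  show ?thesis
    unfolding tendsto_PInfty
  proof
    fix b :: real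
    have "\<forall>\<^sub>F \<alpha> in F. ereal (b + 1 + 2 * M) < pt_dist w1 (C \<alpha>)"
      using lim unfolding tendsto_PInfty by blast
    then show "\<forall>\<^sub>F \<alpha> in F. ereal b < gap_dist W (C \<alpha>)"
    proof eventually_elim
      case (elim \<alpha>)
      have "ereal (b + 1) \<le> gap_dist W (C \<alpha>)"
        unfolding gap_dist_def
      proof (intro INF_greatest)
        fix w c assume w: "w \<in> W" and c: "c \<in> C \<alpha>"
        have "pt_dist w1 (C \<alpha>) \<le> ereal (norm (w1 - c))"
          unfolding pt_dist_def using c by (rule INF_lower)
        with elim have "ereal (b + 1 + 2 * M) < ereal (norm (w1 - c))"
          by (rule less_le_trans)
        moreover have "norm (w1 - c) \<le> norm w1 + norm w + norm (w - c)"
          using norm_triangle_ineq[of "w1 - w" "w - c"] norm_triangle_ineq4[of w1 w] by simp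
        ultimately show "ereal (b + 1) \<le> ereal (norm (w - c))"
          using M[OF w] M[OF w1] by simp
      qed
      then show ?case
        by (rule less_le_trans[rotated]) simp
    qed
  qed
qed

text \<open>The gap is an infimum of point distances over \<open>W\<close>, so a single
  \<open>w\<close> decides.\<close>

lemma wijsman_imp_gap_upper_bound:
  assumes wij: "wijsman_converges C C0 F" and a: "gap_dist W C0 < a"
  shows "\<forall>\<^sub>F \<alpha> in F. gap_dist W (C \<alpha>) < a"
proof -
  obtain w where w: "w \<in> W" "pt_dist w C0 < a"
    using a unfolding gap_dist_def pt_dist_def by (auto simp: INF_less_iff)
  have "\<forall>\<^sub>F \<alpha> in F. pt_dist w (C \<alpha>) < a"
    using wij w(2) unfolding wijsman_converges_def by (blast dest: order_tendstoD(2))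
  then show ?thesis
  proof eventually_elim
    case (elim \<alpha>)
    have "gap_dist W (C \<alpha>) \<le> pt_dist w (C \<alpha>)"
      unfolding gap_dist_def pt_dist_def using w(1) by (rule INF_lower)
    then show ?case
      using elim by (rule le_less_trans)
  qed
qed

lemma wijsman_coercive_imp_slice:
  fixes C0 :: "('a::banach \<times> real) set"
  assumes fr: "frechet_differentiable_norm TYPE('a)"
    and C0: "convex C0" and coer: "\<And>x s. (x, s) \<in> C0 \<Longrightarrow> norm x \<le> s + B"
    and wij: "wijsman_converges C C0 F"
    and conv: "\<forall>\<^sub>F \<alpha> in F. convex (C \<alpha>)"
  shows "slice_converges C C0 F"
  unfolding slice_converges_def
proof (intro allI impI, elim conjE)
  fix W :: "('a \<times> real) set" assume W: "bounded W" "convex W"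
  consider "W = {}" | "C0 = {}" | "W \<noteq> {}" "C0 \<noteq> {}"
    by blast
  then show "((\<lambda>\<alpha>. gap_dist W (C \<alpha>)) \<longlongrightarrow> gap_dist W C0) F"
  proof cases
    case 1
    then show ?thesis
      by (simp add: gap_dist_def)
  next
    case 2
    have "gap_dist W {} = \<infinity>"
      by (cases "W = {}") (simp_all add: gap_dist_def top_ereal_def)
    then show ?thesis
      using wijsman_empty_imp_gap_tendsto_PInfty[of C F W] wij W(1) 2 by simp
  next
    case 3
    show ?thesis
    proof (rule order_tendstoI)
      fix a assume a: "a < gap_dist W C0"
      show "\<forall>\<^sub>F \<alpha> in F. a < gap_dist W (C \<alpha>)"
      \<comment> \<open>Gaps are nonnegative, which settles negative \<open>a\<close>; otherwise the
        intermediate \<open>d\<close> is positive, as the separation argument requires.\<close>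
      proof (cases "a < 0")
        case True
        have "0 \<le> gap_dist W (C \<alpha>)" for \<alpha>
          unfolding gap_dist_def by (intro INF_greatest) simp
        then show ?thesis
          using True by (intro always_eventually allI) (rule less_le_trans)
      next
        case False
        obtain d where d: "a < ereal d" "ereal d < gap_dist W C0"
          using ereal_dense2[OF a] by blast
        obtain a' where a': "a = ereal a'" "a' \<ge> 0"
          using False d(1) by (cases a) auto
        have dW: "d \<le> norm (w - c)" if "w \<in> W" "c \<in> C0" for w c
        proof -
          have "gap_dist W C0 \<le> ereal (norm (w - c))"
            unfolding gap_dist_def by (rule order_trans[OF INF_lower[OF that(1)] INF_lower[OF that(2)]])
          then show ?thesis
            using d(2) by (metis ereal_less_eq(3) less_imp_le order_trans)
        qed
        \<comment> \<open>The choice \<open>\<eta> = (d - a') / 2\<close> puts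
          \<open>d - \<eta>\<close> midway between \<open>a'\<close> and \<open>d\<close>, so the
          infimum stays strictly above \<open>a\<close>.\<close>
        have "\<forall>\<^sub>F \<alpha> in F. \<forall>w\<in>W. \<forall>c\<in>C \<alpha>. norm (w - c) > d - (d - a') / 2"
          using d(1) a'
          by (intro wijsman_imp_gap_lower_bound[OF fr W(2) 3(1) W(1) C0 3(2) coer wij conv dW]) auto
        then show ?thesis
        proof eventually_elim
          case (elim \<alpha>)
          have "ereal (d - (d - a') / 2) \<le> gap_dist W (C \<alpha>)"
            unfolding gap_dist_def using elim by (intro INF_greatest) (auto intro: less_imp_le)
          then show ?case
            by (rule less_le_trans[rotated]) (use d(1) a' in \<open>simp add: field_simps\<close>)
        qed
      qed
    next
      fix a assume "gap_dist W C0 < a"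
      then show "\<forall>\<^sub>F \<alpha> in F. gap_dist W (C \<alpha>) < a"
        by (rule wijsman_imp_gap_upper_bound[OF wij])
    qed
  qed
qed

(* The norm of the library type 'a \<times> real is the l2 product norm (norm_prod_def). *)
theorem theorem3p12:
  fixes f :: "'a::banach \<Rightarrow> ereal"
    and f\<alpha> :: "'i \<Rightarrow> 'a \<Rightarrow> ereal"
    and I :: "'i set" and r :: "'i rel"
  assumes "infinite_dimensional TYPE('a)"
    and "frechet_differentiable_norm TYPE('a)"
    and "never_minus_infinity f" and "convex_fun f" and "lsc_fun f"
    and "((\<lambda>x. f x / ereal (norm x)) \<longlongrightarrow> \<infinity>) at_infinity"
    and "directed_set I r"
    and "\<And>\<alpha>. \<alpha> \<in> I \<Longrightarrow>
           never_minus_infinity (f\<alpha> \<alpha>) \<and> lsc_fun (f\<alpha> \<alpha>) \<and> convex_fun (f\<alpha> \<alpha>)"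
    and "wijsman_converges (\<lambda>\<alpha>. epi (f\<alpha> \<alpha>)) (epi f) (net_filter I r)"
  shows "(radon_nikodym_property TYPE('a) \<longrightarrow>
            slice_converges (\<lambda>\<alpha>. epi (f\<alpha> \<alpha>)) (epi f) (net_filter I r)) \<and>
         ((\<forall>t::real. compactin weak_topology {x. f x \<le> ereal t}) \<longrightarrow>
            slice_converges (\<lambda>\<alpha>. epi (f\<alpha> \<alpha>)) (epi f) (net_filter I r))"
proof -
  obtain B where B: "\<And>x s. (x, s) \<in> epi f \<Longrightarrow> norm x \<le> s + B"
    using superlinear_imp_norm_bound[OF assms(3-6)] by blast
  \<comment> \<open>Convexity is known for indices in \<open>I\<close> only; the tail beyond any
    \<open>i\<close> in \<open>I\<close> consists of such indices.\<close>
  obtain i where "i \<in> I"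
    using assms(7) by (auto simp: directed_set_def)
  then have "\<forall>\<^sub>F \<alpha> in net_filter I r. convex (epi (f\<alpha> \<alpha>))"
    unfolding eventually_net_filter[OF assms(7)] using assms(8) convex_epi by blast
  then have "slice_converges (\<lambda>\<alpha>. epi (f\<alpha> \<alpha>)) (epi f) (net_filter I r)"
    by (intro wijsman_coercive_imp_slice[OF assms(2) convex_epi[OF assms(4)] B assms(9)])
  then show ?thesis
    by blast
qed

end
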